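(* Let $P$ and $Q$ be probability distributions on a measurable space $(\mathcal{X},\mathcal{F})$. The Rényi divergence $D_\alpha(P\|Q)$ is continuous in $\alpha$ (as an extended-real-valued function) on $$\mathcal{A}=\{\alpha\in[-\infty,\infty]\mid 0\le\alpha\le1\text{ or }|D_\alpha(P\|Q)|<\infty\}.$$
   Context: Let $P,Q$ have densities $p,q$ with respect to a dominating $\sigma$-finite measure $\mu$ (whose choice is immaterial). For finite real $\alpha\notin\{0,1\}$, $D_\alpha(P\|Q)=\frac{1}{\alpha-1}\ln\int p^\alpha q^{1-\alpha}\,d\mu\in[-\infty,\infty]$, where for $\alpha>1$ one reads $p^\alpha q^{1-\alpha}$ as $p^\alpha/q^{\alpha-1}$ and for $\alpha<0$ as $q^{1-\alpha}/p^{-\alpha}$, with the conventions $0/0=0$ and $x/0=\infty$ for $x>0$. The remaining orders are defined by $D_0(P\|Q)=\lim_{\alpha\downarrow0}D_\alpha(P\|Q)$, $D_1(P\|Q)=\lim_{\alpha\uparrow1}D_\alpha(P\|Q)$, $D_\infty(P\|Q)=\lim_{\alpha\uparrow\infty}D_\alpha(P\|Q)$ and $D_{-\infty}(P\|Q)=\lim_{\alpha\downarrow-\infty}D_\alpha(P\|Q)$ (these limits always exist). *)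

theory Defs
  imports "HOL-Probability.Probability"
begin

definition ln_ennreal :: "ennreal \<Rightarrow> ereal" where
  "ln_ennreal x =
     (if x = 0 then - \<infinity> else if x = \<top> then \<infinity> else ereal (ln (enn2real x)))"

text \<open>
  The densities are real-valued and non-negative, so every exponent below is applied to a
  non-negative real and is positive; \<open>0 powr r = 0\<close> is then the usual value.
  Division on \<^typ>\<open>ennreal\<close> satisfies \<open>0 / 0 = 0\<close> and \<open>x / 0 = \<top>\<close> for \<open>x > 0\<close>, which are exactly
  the conventions needed for \<open>\<alpha> > 1\<close> and \<open>\<alpha> < 0\<close>.
\<close>

definition renyi_integrand :: "real \<Rightarrow> real \<Rightarrow> real \<Rightarrow> ennreal" where
  "renyi_integrand \<alpha> u v =
     (if \<alpha> > 1 then ennreal (u powr \<alpha>) / ennreal (v powr (\<alpha> - 1))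
      else if \<alpha> < 0 then ennreal (v powr (1 - \<alpha>)) / ennreal (u powr (- \<alpha>))
      else ennreal (u powr \<alpha> * v powr (1 - \<alpha>)))"

lemma zero_divide_zero_ennreal: "(0 :: ennreal) / 0 = 0"
  by simp

lemma divide_zero_ennreal: "(x :: ennreal) > 0 \<Longrightarrow> x / 0 = \<top>"
  by (simp add: ennreal_divide_zero)

text \<open>Used only for \<open>\<alpha> \<notin> {0, 1}\<close>.\<close>

definition renyi_simple ::
  "'a measure \<Rightarrow> ('a \<Rightarrow> real) \<Rightarrow> ('a \<Rightarrow> real) \<Rightarrow> real \<Rightarrow> ereal" where
  "renyi_simple \<mu> p q \<alpha> =
     ereal (1 / (\<alpha> - 1)) * ln_ennreal (\<integral>\<^sup>+ x. renyi_integrand \<alpha> (p x) (q x) \<partial>\<mu>)"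

definition renyi_divergence ::
  "'a measure \<Rightarrow> ('a \<Rightarrow> real) \<Rightarrow> ('a \<Rightarrow> real) \<Rightarrow> ereal \<Rightarrow> ereal" where
  "renyi_divergence \<mu> p q \<alpha> =
     (if \<alpha> = \<infinity> then Lim at_top (renyi_simple \<mu> p q)
      else if \<alpha> = - \<infinity> then Lim at_bot (renyi_simple \<mu> p q)
      else if \<alpha> = 0 then Lim (at_right 0) (renyi_simple \<mu> p q)
      else if \<alpha> = 1 then Lim (at_left 1) (renyi_simple \<mu> p q)
      else renyi_simple \<mu> p q (real_of_ereal \<alpha>))"

text \<open>
  Any two probability measures on the same measurable space have real-valued densities with respect
  to a common \<open>\<sigma>\<close>-finite measure, so a statement quantified over \<open>\<mu>\<close>, \<open>p\<close> and \<open>q\<close> covers every pair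
  \<open>P\<close>, \<open>Q\<close>, and it covers every choice of dominating measure and of versions of the densities.
\<close>

lemma exists_common_densities:
  fixes P Q :: "'a measure"
  assumes "prob_space P" and "prob_space Q" and S: "sets Q = sets P"
  shows "\<exists>(\<mu> :: 'a measure) p q. sigma_finite_measure \<mu> \<and>
           p \<in> borel_measurable \<mu> \<and> q \<in> borel_measurable \<mu> \<and>
           (\<forall>x. 0 \<le> p x) \<and> (\<forall>x. 0 \<le> q x) \<and>
           P = density \<mu> (\<lambda>x. ennreal (p x)) \<and> Q = density \<mu> (\<lambda>x. ennreal (q x))"
proof -
  interpret P: prob_space P by fact
  interpret Q: prob_space Q by fact
  define \<mu> where "\<mu> = measure_of (space P) (sets P) (\<lambda>A. emeasure P A + emeasure Q A)"
  have sets_\<mu>: "sets \<mu> = sets P" and space_\<mu>: "space \<mu> = space P"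
    by (simp_all add: \<mu>_def sets.sigma_sets_eq)
  have em: "emeasure \<mu> A = emeasure P A + emeasure Q A" if "A \<in> sets P" for A
  proof (rule emeasure_measure_of[OF \<mu>_def])
    show "sets P \<subseteq> Pow (space P)" by (rule sets.space_closed)
    show "A \<in> sets \<mu>" using that sets_\<mu> by simp
    show "positive (sets \<mu>) (\<lambda>A. emeasure P A + emeasure Q A)"
      by (simp add: positive_def)
    show "countably_additive (sets \<mu>) (\<lambda>A. emeasure P A + emeasure Q A)"
    proof (rule countably_additiveI)
      fix F :: "nat \<Rightarrow> 'a set"
      assume F: "range F \<subseteq> sets \<mu>" "disjoint_family F" "(\<Union>i. F i) \<in> sets \<mu>"
      have "(\<Sum>i. emeasure P (F i) + emeasure Q (F i))
          = (\<Sum>i. emeasure P (F i)) + (\<Sum>i. emeasure Q (F i))"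
        by (rule suminf_add[symmetric]) auto
      also have "\<dots> = emeasure P (\<Union>i. F i) + emeasure Q (\<Union>i. F i)"
        using F S sets_\<mu> by (simp add: suminf_emeasure)
      finally show "(\<Sum>i. emeasure P (F i) + emeasure Q (F i))
          = emeasure P (\<Union>i. F i) + emeasure Q (\<Union>i. F i)" .
    qed
  qed
  have "emeasure \<mu> (space \<mu>) \<noteq> \<infinity>"
    using em[of "space P"] S by (simp add: space_\<mu> Q.emeasure_eq_measure P.emeasure_eq_measure)
  then interpret M: finite_measure \<mu> by (rule finite_measureI)
  have ex: "\<exists>d. d \<in> borel_measurable \<mu> \<and> (\<forall>x. 0 \<le> d x) \<and> N = density \<mu> (\<lambda>x. ennreal (d x))"
    if N: "finite_measure N" "sets N = sets \<mu>"
      and le: "\<And>A. A \<in> sets P \<Longrightarrow> emeasure N A \<le> emeasure \<mu> A" for N :: "'a measure"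
  proof -
    have ac: "absolutely_continuous \<mu> N"
      unfolding absolutely_continuous_def
    proof
      fix A assume "A \<in> null_sets \<mu>"
      then show "A \<in> null_sets N"
        using N le[of A] sets_\<mu> by (auto simp: null_sets_def)
    qed
    obtain d where d: "d \<in> borel_measurable \<mu>" "AE x in \<mu>. RN_deriv \<mu> N x = ennreal (d x)"
        "\<And>x. 0 \<le> d x"
      using M.real_RN_deriv[OF N(1) ac N(2)] by metis
    have "N = density \<mu> (RN_deriv \<mu> N)"
      using M.density_RN_deriv[OF ac N(2)] by simp
    also have "\<dots> = density \<mu> (\<lambda>x. ennreal (d x))"
      using d by (intro density_cong) auto
    finally show ?thesis using d by blast
  qed
  obtain p where p: "p \<in> borel_measurable \<mu>" "\<forall>x. 0 \<le> p x"
      "P = density \<mu> (\<lambda>x. ennreal (p x))"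
    using ex[OF P.finite_measure_axioms] em sets_\<mu> by auto
  obtain q where q: "q \<in> borel_measurable \<mu>" "\<forall>x. 0 \<le> q x"
      "Q = density \<mu> (\<lambda>x. ennreal (q x))"
    using ex[OF Q.finite_measure_axioms] em sets_\<mu> S by auto
  show ?thesis
    using M.sigma_finite_measure_axioms p q by blast
qed

end

(* On the relevant orders the integral defining D_alpha is the Hellinger integral
   G(alpha) = int p^alpha q^(1-alpha) over {p > 0, q > 0}: off [0,1] the two differ only if the former
   is infinite.  G is continuous where it is finite, since p^alpha q^(1-alpha) is dominated by the sum of its
   values at two enclosing exponents; this settles finite orders other than 1.  Log-convexity of G together
   with G(1) <= 1 makes D_alpha monotone on each side of 1, so the limits defining the orders 1 and
   +-infinity exist.  If moreover G is finite somewhere above 1 and P << Q, then G(1) = 1 and G is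
   differentiable at 1 by dominated convergence, so the one-sided limits of ln G(alpha) / (alpha - 1) at 1
   agree. *)

theory Submission
  imports Defs
begin

section \<open>Limits of monotone functions and filters on the extended reals\<close>

text \<open>Supplies the limit behind order \<infinity>. Monotonicity is asked only beyond
  \<open>a\<close>, because the lemma is applied to the orders above 1.\<close>

lemma tendsto_at_top_mono_ereal:
  fixes f :: "real \<Rightarrow> ereal"
  assumes mono: "\<And>x y. a < x \<Longrightarrow> x \<le> y \<Longrightarrow> f x \<le> f y"
  shows "(f \<longlongrightarrow> (SUP x\<in>{a<..}. f x)) at_top"
proof (rule order_tendstoI)
  fix l assume "l < (SUP x\<in>{a<..}. f x)"
  then obtain x where x: "a < x" "l < f x" by (auto simp: less_SUP_iff)
  show "eventually (\<lambda>y. l < f y) at_top"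
    using eventually_ge_at_top[of x] by eventually_elim (meson mono x order_less_le_trans)
next
  fix u assume u: "(SUP x\<in>{a<..}. f x) < u"
  show "eventually (\<lambda>y. f y < u) at_top"
    using eventually_gt_at_top[of a]
    by eventually_elim (rule le_less_trans[OF SUP_upper u], simp)
qed

lemma tendsto_at_bot_mono_ereal:
  fixes f :: "real \<Rightarrow> ereal"
  assumes mono: "\<And>x y. y < a \<Longrightarrow> x \<le> y \<Longrightarrow> f x \<le> f y"
  shows "(f \<longlongrightarrow> (INF x\<in>{..<a}. f x)) at_bot"
proof (rule order_tendstoI)
  fix u assume "(INF x\<in>{..<a}. f x) < u"
  then obtain x where x: "x < a" "f x < u" by (auto simp: INF_less_iff)
  show "eventually (\<lambda>y. f y < u) at_bot"
    using eventually_le_at_bot[of x] by eventually_elim (meson mono x order_le_less_trans)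
next
  fix l assume l: "l < (INF x\<in>{..<a}. f x)"
  show "eventually (\<lambda>y. l < f y) at_bot"
    using eventually_gt_at_bot[of a]
    by eventually_elim (rule less_le_trans[OF l INF_lower], simp)
qed

lemma tendsto_at_left_mono_ereal:
  fixes f :: "real \<Rightarrow> ereal"
  assumes mono: "\<And>x y. y < a \<Longrightarrow> x \<le> y \<Longrightarrow> f x \<le> f y"
  shows "(f \<longlongrightarrow> (SUP x\<in>{..<a}. f x)) (at_left a)"
  using Lim_left_bound[of UNIV a f \<infinity>] mono by simp

text \<open>As -\<infinity> is the least element, its punctured neighbourhoods are right
  neighbourhoods.\<close>

lemma at_minus_infty_ereal_eq_at_bot: "at (- \<infinity>) = filtermap ereal at_bot"
proof -
  have "at (- \<infinity> :: ereal) = at_right (- \<infinity>)"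
    by (rule filter_eq_iff[THEN iffD2]) (auto simp: eventually_at_filter elim!: eventually_mono)
  then show ?thesis by (simp add: at_right_MInf)
qed

text \<open>Neighbourhoods of \<open>ereal r\<close> come from real neighbourhoods of
  \<open>r\<close>, so a limit over real orders transfers to \<open>A\<close>. The functions may
  disagree at \<open>r\<close> itself, which matters at order 1.\<close>

lemma tendsto_at_ereal_within:
  assumes "(g \<longlongrightarrow> l) (at r within S)"
    and "\<And>\<alpha>. ereal \<alpha> \<in> A \<Longrightarrow> \<alpha> \<noteq> r \<Longrightarrow> \<alpha> \<in> S \<and> f (ereal \<alpha>) = g \<alpha>"
  shows "(f \<longlongrightarrow> l) (at (ereal r) within A)"
  unfolding tendsto_def
proof (intro allI impI)
  fix U assume "open U" "l \<in> U"
  then have "eventually (\<lambda>\<alpha>. g \<alpha> \<in> U) (at r within S)"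
    using assms(1) by (auto simp: tendsto_def)
  then show "eventually (\<lambda>\<alpha>. f \<alpha> \<in> U) (at (ereal r) within A)"
    by (auto simp: eventually_at_filter nhds_ereal eventually_filtermap assms(2) elim: eventually_mono)
qed

text \<open>After division by \<open>\<bar>s\<bar>\<close> the bound no longer depends on
  \<open>s\<close>, so it dominates difference quotients at 0. It comes from convexity of exp
  between 0 and \<plusminus>\<delta>y, with weight \<open>\<bar>s\<bar> / \<delta>\<close>.\<close>

lemma abs_exp_minus_1_le:
  fixes s y \<delta> :: real
  assumes "0 < \<delta>" "\<bar>s\<bar> \<le> \<delta>"
  shows "\<bar>exp (s * y) - 1\<bar> \<le> \<bar>s\<bar> / \<delta> * (exp (\<delta> * y) + exp (- \<delta> * y))"
proof -
  define u where "u = \<bar>s\<bar> / \<delta>"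
  have u: "0 \<le> u" "u \<le> 1" "u * \<delta> = \<bar>s\<bar>" using assms by (auto simp: u_def)
  have conv: "exp (u * z) \<le> 1 + u * exp z" for z :: real
  proof -
    have "exp (u * z) \<le> (1 - u) * exp 0 + u * exp z"
      using convex_onD[OF exp_convex, of u 0 z] u by simp
    then show ?thesis using u by simp
  qed
  have up: "exp (r * y) - 1 \<le> u * (exp (\<delta> * y) + exp (- \<delta> * y))" if "\<bar>r\<bar> = \<bar>s\<bar>" for r
  proof -
    have "r = u * \<delta> \<or> r = - (u * \<delta>)"
      using that u(3) by linarith
    then have "r * y = u * (\<delta> * y) \<or> r * y = u * (- \<delta> * y)"
      by auto
    then have "exp (r * y) \<le> 1 + u * exp (\<delta> * y) \<or> exp (r * y) \<le> 1 + u * exp (- \<delta> * y)"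
      using conv[of "\<delta> * y"] conv[of "- \<delta> * y"] by metis
    moreover have "0 \<le> u * exp (\<delta> * y)" "0 \<le> u * exp (- \<delta> * y)" using u by auto
    ultimately show ?thesis by (auto simp: algebra_simps)
  qed
  \<comment> \<open>Since exp(sy) + exp(-sy) \<ge> 2, the lower estimate for s reduces to the upper
    estimate for -s.\<close>
  have "1 + s * y \<le> exp (s * y)" "1 + - s * y \<le> exp (- s * y)"
    by (rule exp_ge_add_one_self)+
  then have "1 - exp (s * y) \<le> exp (- s * y) - 1" by linarith
  then show ?thesis
    using up[of s] up[of "- s"] unfolding u_def by simp
qed

section \<open>The Hellinger integral: finiteness and continuity in the order\<close>

locale density_pair =
  fixes \<mu> :: "'a measure" and p q :: "'a \<Rightarrow> real"
  assumes p_measurable [measurable]: "p \<in> borel_measurable \<mu>"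
    and q_measurable [measurable]: "q \<in> borel_measurable \<mu>"
    and p_nonneg: "\<And>x. 0 \<le> p x" and q_nonneg: "\<And>x. 0 \<le> q x"
    and nn_integral_p: "(\<integral>\<^sup>+ x. ennreal (p x) \<partial>\<mu>) = 1"
    and nn_integral_q: "(\<integral>\<^sup>+ x. ennreal (q x) \<partial>\<mu>) = 1"
begin

text \<open>The unnormalised geometric mixture of the two densities. Because
  \<open>0 powr r = 0\<close> for every \<open>r\<close>, including 0 and negative \<open>r\<close>,
  it vanishes at all orders where \<open>p\<close> or \<open>q\<close> does.\<close>

definition tilt :: "real \<Rightarrow> 'a \<Rightarrow> real" where
  "tilt \<alpha> x = p x powr \<alpha> * q x powr (1 - \<alpha>)"

definition hellinger :: "real \<Rightarrow> ennreal" where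
  "hellinger \<alpha> = (\<integral>\<^sup>+ x. ennreal (tilt \<alpha> x) \<partial>\<mu>)"

definition hellinger_real :: "real \<Rightarrow> real" where
  "hellinger_real \<alpha> = (\<integral> x. tilt \<alpha> x \<partial>\<mu>)"

text \<open>The candidate for the divergence at orders other than 1. At order 1 the factor
  \<open>1 / 0 = 0\<close> yields a default value, so there only limits carry meaning.\<close>

definition hellinger_rate :: "real \<Rightarrow> ereal" where
  "hellinger_rate \<alpha> = ereal (1 / (\<alpha> - 1)) * ln_ennreal (hellinger \<alpha>)"

lemma tilt_measurable [measurable]: "tilt \<alpha> \<in> borel_measurable \<mu>"
  unfolding tilt_def by measurable

lemma tilt_nonneg: "0 \<le> tilt \<alpha> x"
  by (simp add: tilt_def)

lemma tilt_eq_0_iff: "tilt \<alpha> x = 0 \<longleftrightarrow> p x = 0 \<or> q x = 0"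
  by (simp add: tilt_def)

lemma tilt_eq_exp:
  assumes "p x \<noteq> 0" "q x \<noteq> 0"
  shows "tilt \<alpha> x = exp (\<alpha> * ln (p x) + (1 - \<alpha>) * ln (q x))"
  using assms by (simp add: tilt_def powr_def exp_add)

text \<open>In the order, \<open>tilt\<close> is the exponential of an affine function, hence
  monotone in the direction given by the sign of ln(p/q). One endpoint therefore bounds it, and the
  sum covers both signs.\<close>

lemma tilt_le_endpoints:
  assumes "a \<le> \<alpha>" "\<alpha> \<le> b"
  shows "tilt \<alpha> x \<le> tilt a x + tilt b x"
proof (cases "p x = 0 \<or> q x = 0")
  case True
  then show ?thesis by (auto simp: tilt_def)
next
  case False
  define y where "y = ln (p x) - ln (q x)"
  have eq: "tilt c x = exp (ln (q x) + c * y)" for c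
    using False by (simp add: tilt_eq_exp y_def algebra_simps)
  show ?thesis
  proof (cases "y \<ge> 0")
    case True
    then have "tilt \<alpha> x \<le> tilt b x" using assms by (simp add: eq mult_right_mono)
    then show ?thesis using tilt_nonneg[of a x] by simp
  next
    case False
    then have "tilt \<alpha> x \<le> tilt a x" using assms by (simp add: eq mult_right_mono_neg)
    then show ?thesis using tilt_nonneg[of b x] by simp
  qed
qed

text \<open>Equality can fail only where exactly one density vanishes. This lost mass is why
  \<open>hellinger 0\<close> and \<open>hellinger 1\<close> may be less than 1.\<close>

lemma tilt_le_densities:
  shows "tilt 0 x \<le> q x" "tilt 1 x \<le> p x"
  using p_nonneg[of x] q_nonneg[of x] by (auto simp: tilt_def le_less)

lemma hellinger_0_le: "hellinger 0 \<le> 1"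
proof -
  have "hellinger 0 \<le> (\<integral>\<^sup>+ x. ennreal (q x) \<partial>\<mu>)"
    unfolding hellinger_def by (intro nn_integral_mono ennreal_leI tilt_le_densities)
  then show ?thesis by (simp add: nn_integral_q)
qed

lemma hellinger_1_le: "hellinger 1 \<le> 1"
proof -
  have "hellinger 1 \<le> (\<integral>\<^sup>+ x. ennreal (p x) \<partial>\<mu>)"
    unfolding hellinger_def by (intro nn_integral_mono ennreal_leI tilt_le_densities)
  then show ?thesis by (simp add: nn_integral_p)
qed

lemma hellinger_finite_between:
  assumes "a \<le> \<alpha>" "\<alpha> \<le> b" "hellinger a < \<top>" "hellinger b < \<top>"
  shows "hellinger \<alpha> < \<top>"
proof -
  have "hellinger \<alpha> \<le> (\<integral>\<^sup>+ x. ennreal (tilt a x) + ennreal (tilt b x) \<partial>\<mu>)"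
    unfolding hellinger_def using tilt_le_endpoints[OF assms(1,2)]
    by (intro nn_integral_mono) (simp add: tilt_nonneg flip: ennreal_plus)
  also have "\<dots> = hellinger a + hellinger b"
    unfolding hellinger_def by (intro nn_integral_add) auto
  also have "\<dots> < \<top>" using assms by simp
  finally show ?thesis .
qed

lemma hellinger_finite_unit: "0 \<le> \<alpha> \<Longrightarrow> \<alpha> \<le> 1 \<Longrightarrow> hellinger \<alpha> < \<top>"
  by (rule hellinger_finite_between[of 0 \<alpha> 1])
     (use hellinger_0_le hellinger_1_le in \<open>auto intro: le_less_trans[OF _ ennreal_one_less_top]\<close>)

lemma tilt_integrable: "hellinger \<alpha> < \<top> \<Longrightarrow> integrable \<mu> (tilt \<alpha>)"
  by (intro integrableI_nonneg) (auto simp: hellinger_def tilt_nonneg)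

lemma hellinger_real_nonneg: "0 \<le> hellinger_real \<alpha>"
  by (simp add: hellinger_real_def tilt_nonneg)

lemma hellinger_eq_real: "hellinger \<alpha> < \<top> \<Longrightarrow> hellinger \<alpha> = ennreal (hellinger_real \<alpha>)"
  unfolding hellinger_def hellinger_real_def
  by (intro nn_integral_eq_integral tilt_integrable) (auto simp: tilt_nonneg hellinger_def)

text \<open>A convergent sequence together with its limit is compact, so its exponents stay between two
  exponents of the domain of finiteness, and these supply the dominating function.\<close>

lemma continuous_on_hellinger_real: "continuous_on {\<alpha>. hellinger \<alpha> < \<top>} hellinger_real"
proof (rule continuous_on_sequentiallyI)
  fix u :: "nat \<Rightarrow> real" and r
  assume u: "\<forall>n. u n \<in> {\<alpha>. hellinger \<alpha> < \<top>}" and r: "r \<in> {\<alpha>. hellinger \<alpha> < \<top>}"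
    and lim: "u \<longlonglongrightarrow> r"
  define S where "S = insert r (range u)"
  have S: "compact S" "S \<noteq> {}" "S \<subseteq> {\<alpha>. hellinger \<alpha> < \<top>}"
    using compact_sequence_with_limit[OF lim] u r by (auto simp: S_def)
  obtain a b where ab: "a \<in> S" "b \<in> S" "\<And>s. s \<in> S \<Longrightarrow> a \<le> s" "\<And>s. s \<in> S \<Longrightarrow> s \<le> b"
    using compact_attains_inf[OF S(1,2)] compact_attains_sup[OF S(1,2)] by metis
  show "(\<lambda>n. hellinger_real (u n)) \<longlonglongrightarrow> hellinger_real r"
    unfolding hellinger_real_def
  proof (rule integral_dominated_convergence)
    show "integrable \<mu> (\<lambda>x. tilt a x + tilt b x)"
      using ab S by (intro Bochner_Integration.integrable_add tilt_integrable) auto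
    show "AE x in \<mu>. norm (tilt (u n) x) \<le> tilt a x + tilt b x" for n
      using ab by (auto simp: tilt_nonneg S_def intro!: tilt_le_endpoints)
    show "AE x in \<mu>. (\<lambda>n. tilt (u n) x) \<longlonglongrightarrow> tilt r x"
    proof (rule AE_I2)
      fix x
      show "(\<lambda>n. tilt (u n) x) \<longlonglongrightarrow> tilt r x"
      proof (cases "p x = 0 \<or> q x = 0")
        case True
        then have "tilt c x = 0" for c by (simp add: tilt_eq_0_iff)
        then show ?thesis by simp
      next
        case False
        then show ?thesis unfolding tilt_def by (intro tendsto_intros lim) auto
      qed
    qed
  qed auto
qed

section \<open>Log-convexity and monotonicity on either side of order 1\<close>

text \<open>The right-hand side, mutual singularity, does not mention the order: the integral
  vanishes at all orders or at none.\<close>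

lemma hellinger_eq_0_iff: "hellinger \<alpha> = 0 \<longleftrightarrow> (AE x in \<mu>. p x = 0 \<or> q x = 0)"
proof -
  have "ennreal (tilt \<alpha> x) = 0 \<longleftrightarrow> p x = 0 \<or> q x = 0" for x
    using tilt_nonneg[of \<alpha> x] by (metis ennreal_0 ennreal_inj order_refl tilt_eq_0_iff)
  then show ?thesis
    unfolding hellinger_def by (subst nn_integral_0_iff_AE) auto
qed

text \<open>Weighted arithmetic-geometric mean inequality, applied to the normalised tilted density and
  \<open>p\<close>: this is log-convexity of the Hellinger integral along segments ending at order 1.\<close>

lemma ln_hellinger_segment:
  assumes t: "0 < t" "t \<le> 1"
  shows "ln_ennreal (hellinger (1 + t * (\<alpha> - 1))) \<le> ereal t * ln_ennreal (hellinger \<alpha>)"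
proof (cases "hellinger \<alpha> = 0 \<or> hellinger \<alpha> = \<top>")
  case True
  then show ?thesis
  proof
    assume "hellinger \<alpha> = 0"
    then have "hellinger (1 + t * (\<alpha> - 1)) = 0" by (simp add: hellinger_eq_0_iff)
    then show ?thesis by (simp add: ln_ennreal_def)
  next
    assume "hellinger \<alpha> = \<top>"
    then show ?thesis using t by (simp add: ln_ennreal_def)
  qed
next
  case False
  then have fin: "hellinger \<alpha> < \<top>" by (simp add: less_top)
  define c where "c = hellinger_real \<alpha>"
  have hc: "hellinger \<alpha> = ennreal c" using hellinger_eq_real[OF fin] by (simp add: c_def)
  have c: "c > 0" using False hc hellinger_real_nonneg[of \<alpha>] by (auto simp: c_def le_less)
  define \<beta> where "\<beta> = 1 + t * (\<alpha> - 1)"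
  \<comment> \<open>The normalised \<open>tilt \<alpha> / c\<close> and \<open>p\<close> both have
    mass 1, so the bracket integrates to t + (1 - t) = 1 and the bound to
    \<open>c powr t\<close>.\<close>
  have pt: "tilt \<beta> x \<le> c powr t * (t / c * tilt \<alpha> x + (1 - t) * p x)" for x
  proof (cases "p x = 0 \<or> q x = 0")
    case True
    then have "tilt \<beta> x = 0" by (simp add: tilt_eq_0_iff)
    moreover have "0 \<le> c powr t * (t / c * tilt \<alpha> x + (1 - t) * p x)"
      using c t p_nonneg[of x] tilt_nonneg[of \<alpha> x] by simp
    ultimately show ?thesis by simp
  next
    case False
    then have pos: "p x > 0" "q x > 0" using p_nonneg[of x] q_nonneg[of x] by (auto simp: le_less)
    have tp: "tilt \<alpha> x > 0" using pos by (simp add: tilt_def)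
    have "(tilt \<alpha> x / c) powr t * p x powr (1 - t) \<le> t * (tilt \<alpha> x / c) + (1 - t) * p x"
      using t pos tp c by (intro Youngs_inequality_0) auto
    moreover have "tilt \<beta> x = tilt \<alpha> x powr t * p x powr (1 - t)"
      using pos by (simp add: tilt_def powr_mult powr_powr \<beta>_def algebra_simps flip: powr_add)
    then have "tilt \<beta> x = c powr t * ((tilt \<alpha> x / c) powr t * p x powr (1 - t))"
      using c tp by (simp add: powr_divide)
    ultimately show ?thesis using c by (simp add: mult_left_mono)
  qed
  have "hellinger \<beta> \<le> (\<integral>\<^sup>+ x. ennreal (c powr t * (t / c * tilt \<alpha> x + (1 - t) * p x)) \<partial>\<mu>)"
    unfolding hellinger_def using pt by (intro nn_integral_mono ennreal_leI) auto
  also have "\<dots> = (\<integral>\<^sup>+ x. ennreal (c powr t) * (ennreal (t / c) * ennreal (tilt \<alpha> x) + ennreal (1 - t) * ennreal (p x)) \<partial>\<mu>)"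
    using c t p_nonneg tilt_nonneg
    by (intro nn_integral_cong) (simp add: ennreal_mult ennreal_plus del: times_divide_eq_left)
  also have "\<dots> = ennreal (c powr t) * (ennreal (t / c) * hellinger \<alpha> + ennreal (1 - t) * 1)"
    unfolding hellinger_def
    by (simp add: nn_integral_cmult nn_integral_add nn_integral_p)
  also have "\<dots> = ennreal (c powr t) * ennreal 1"
    using c t by (simp add: hc flip: ennreal_mult ennreal_plus)
  finally have le: "hellinger \<beta> \<le> ennreal (c powr t)" by simp
  show ?thesis unfolding \<beta>_def[symmetric]
  proof (cases "hellinger \<beta> = 0")
    case True
    then show "ln_ennreal (hellinger \<beta>) \<le> ereal t * ln_ennreal (hellinger \<alpha>)"
      by (simp add: ln_ennreal_def)
  next
    case False
    have f: "hellinger \<beta> < \<top>" using le by (simp add: le_less_trans)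
    have h: "hellinger \<beta> = ennreal (hellinger_real \<beta>)" using hellinger_eq_real[OF f] .
    have pos: "hellinger_real \<beta> > 0" using False h hellinger_real_nonneg[of \<beta>] by (auto simp: le_less)
    have "hellinger_real \<beta> \<le> c powr t" using le h c by (simp add: hellinger_real_nonneg)
    then have "ln (hellinger_real \<beta>) \<le> t * ln c"
      using pos c by (metis ln_le_cancel_iff ln_powr powr_gt_zero less_irrefl)
    then show "ln_ennreal (hellinger \<beta>) \<le> ereal t * ln_ennreal (hellinger \<alpha>)"
      using pos c by (simp add: ln_ennreal_def h hc)
  qed
qed

text \<open>Here \<beta> lies on the segment from 1 to \<alpha>, and
  \<open>ln_hellinger_segment\<close> compares the two rates. The estimate is made with the positive
  factors 1/(1 - \<alpha>) and 1/(1 - \<beta>), as scaling in \<open>ereal\<close> preserves order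
  for non-negative factors; the sign is restored at the end.\<close>

lemma hellinger_rate_mono_below_1:
  assumes "\<alpha> \<le> \<beta>" "\<beta> < 1"
  shows "hellinger_rate \<alpha> \<le> hellinger_rate \<beta>"
proof -
  define t where "t = (1 - \<beta>) / (1 - \<alpha>)"
  have t: "0 < t" "t \<le> 1" "1 + t * (\<alpha> - 1) = \<beta>"
    using assms by (auto simp: t_def divide_simps) (simp add: algebra_simps)
  have "ereal (1 / (1 - \<beta>)) * ln_ennreal (hellinger \<beta>)
      \<le> ereal (1 / (1 - \<beta>)) * (ereal t * ln_ennreal (hellinger \<alpha>))"
    using ln_hellinger_segment[OF t(1,2), of \<alpha>] assms t(3) by (intro ereal_mult_left_mono) auto
  also have "\<dots> = ereal (1 / (1 - \<alpha>)) * ln_ennreal (hellinger \<alpha>)"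
    using assms by (simp add: t_def flip: mult.assoc)
  finally have "- (ereal (1 / (1 - \<alpha>)) * ln_ennreal (hellinger \<alpha>))
      \<le> - (ereal (1 / (1 - \<beta>)) * ln_ennreal (hellinger \<beta>))"
    by (simp add: ereal_minus_le_minus)
  moreover have "- (ereal (1 / (1 - c)) * ln_ennreal (hellinger c)) = hellinger_rate c" for c
  proof -
    have "1 / (c - 1) = - (1 / (1 - c))"
      by (metis minus_diff_eq minus_divide_right)
    then show ?thesis by (simp only: hellinger_rate_def flip: ereal_mult_minus_left uminus_ereal.simps(1))
  qed
  ultimately show ?thesis by simp
qed

text \<open>Now \<alpha> is the order nearer to 1, so it is the point on the segment from 1 to
  \<beta>.\<close>

lemma hellinger_rate_mono_above_1:
  assumes "1 < \<alpha>" "\<alpha> \<le> \<beta>"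
  shows "hellinger_rate \<alpha> \<le> hellinger_rate \<beta>"
proof -
  define t where "t = (\<alpha> - 1) / (\<beta> - 1)"
  have t: "0 < t" "t \<le> 1" "1 + t * (\<beta> - 1) = \<alpha>"
    using assms by (auto simp: t_def)
  have "hellinger_rate \<alpha> \<le> ereal (1 / (\<alpha> - 1)) * (ereal t * ln_ennreal (hellinger \<beta>))"
    unfolding hellinger_rate_def
    using ln_hellinger_segment[OF t(1,2), of \<beta>] assms t(3) by (intro ereal_mult_left_mono) auto
  also have "\<dots> = hellinger_rate \<beta>"
    using assms by (simp add: t_def hellinger_rate_def flip: mult.assoc)
  finally show ?thesis .
qed

section \<open>Limits of the rate at finite orders\<close>

text \<open>For mutually singular distributions the rate is \<infinity> below order 1 and
  -\<infinity> above it, hence constant near \<open>r\<close>. Otherwise the integral is positive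
  wherever it is finite, and continuity passes through the logarithm.\<close>

lemma tendsto_hellinger_rate:
  assumes "r \<noteq> 1" "hellinger r < \<top>"
  shows "(hellinger_rate \<longlongrightarrow> hellinger_rate r) (at r within {\<alpha>. hellinger \<alpha> < \<top>})"
proof (cases "AE x in \<mu>. p x = 0 \<or> q x = 0")
  case True
  then have h0: "hellinger \<alpha> = 0" for \<alpha> by (simp add: hellinger_eq_0_iff)
  have "eventually (\<lambda>\<alpha>. \<alpha> \<noteq> 1 \<and> (\<alpha> < 1 \<longleftrightarrow> r < 1)) (nhds r)"
  proof (cases "r < 1")
    case True
    then show ?thesis by (auto simp: eventually_nhds intro!: exI[of _ "{..<1}"])
  next
    case False
    then have "r > 1" using assms by simp
    then show ?thesis by (auto simp: eventually_nhds intro!: exI[of _ "{1<..}"])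
  qed
  then have "eventually (\<lambda>\<alpha>. hellinger_rate \<alpha> = hellinger_rate r) (nhds r)"
    by eventually_elim (use assms in \<open>auto simp: hellinger_rate_def h0 ln_ennreal_def\<close>)
  then have "eventually (\<lambda>\<alpha>. hellinger_rate \<alpha> = hellinger_rate r) (at r within {\<alpha>. hellinger \<alpha> < \<top>})"
    by (auto simp: eventually_at_filter elim: eventually_mono)
  then show ?thesis by (rule tendsto_eventually)
next
  case False
  have pos: "hellinger_real \<alpha> > 0" if "hellinger \<alpha> < \<top>" for \<alpha>
    using False that hellinger_eq_real[OF that] hellinger_real_nonneg[of \<alpha>] hellinger_eq_0_iff[of \<alpha>]
    by (auto simp: le_less)
  have rate: "hellinger_rate \<alpha> = ereal (1 / (\<alpha> - 1) * ln (hellinger_real \<alpha>))" if "hellinger \<alpha> < \<top>" for \<alpha>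
    using pos[OF that] by (simp add: hellinger_rate_def hellinger_eq_real[OF that] ln_ennreal_def)
  have "(hellinger_real \<longlongrightarrow> hellinger_real r) (at r within {\<alpha>. hellinger \<alpha> < \<top>})"
    using continuous_on_hellinger_real assms by (auto simp: continuous_on_def)
  then have "((\<lambda>\<alpha>. ereal (1 / (\<alpha> - 1) * ln (hellinger_real \<alpha>)))
      \<longlongrightarrow> ereal (1 / (r - 1) * ln (hellinger_real r))) (at r within {\<alpha>. hellinger \<alpha> < \<top>})"
    using assms pos[OF assms(2)] by (intro tendsto_intros) auto
  moreover have "eventually (\<lambda>\<alpha>. ereal (1 / (\<alpha> - 1) * ln (hellinger_real \<alpha>)) = hellinger_rate \<alpha>)
      (at r within {\<alpha>. hellinger \<alpha> < \<top>})"
    by (auto simp: eventually_at_filter rate)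
  ultimately show ?thesis
    using rate[OF assms(2)] by (auto intro: Lim_transform_eventually)
qed

text \<open>Exchanging the densities turns order \<alpha> into 1 - \<alpha>, so facts about orders
  above 1 yield those about orders below 0.\<close>

lemma density_pair_swap: "density_pair \<mu> q p"
  by unfold_locales (auto simp: p_nonneg q_nonneg nn_integral_p nn_integral_q)

lemma swap_hellinger: "density_pair.hellinger \<mu> q p (1 - \<alpha>) = hellinger \<alpha>"
proof -
  interpret swap: density_pair \<mu> q p by (rule density_pair_swap)
  show ?thesis
    by (simp add: hellinger_def swap.hellinger_def tilt_def swap.tilt_def mult.commute)
qed

text \<open>Absolute continuity gives \<open>hellinger 1 = 1\<close>, so the rate is the difference
  quotient of ln G at 1 and tends to G'(1)/G(1) = G'(1). Finiteness at \<open>b\<close> provides the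
  domination to the right of 1.\<close>

lemma tendsto_hellinger_rate_at_1:
  assumes ac: "AE x in \<mu>. q x = 0 \<longrightarrow> p x = 0" and b: "1 < b" "hellinger b < \<top>"
  obtains d where "(hellinger_rate \<longlongrightarrow> ereal d) (at 1)"
proof -
  \<comment> \<open>Chosen so that 1 - \<delta> \<ge> 0 and 1 + \<delta> \<le> b: the integral is
    finite at both exponents.\<close>
  define \<delta> where "\<delta> = min 1 (b - 1)"
  have \<delta>: "0 < \<delta>" using b by (simp add: \<delta>_def)
  have fin: "hellinger \<alpha> < \<top>" if "0 \<le> \<alpha>" "\<alpha> \<le> b" for \<alpha>
    using hellinger_finite_between[OF that hellinger_finite_unit b(2)] by simp
  have fin\<delta>: "hellinger (1 + s) < \<top>" if "\<bar>s\<bar> \<le> \<delta>" for s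
    using that by (intro fin) (auto simp: \<delta>_def)
  have "hellinger 1 = (\<integral>\<^sup>+ x. ennreal (p x) \<partial>\<mu>)"
    unfolding hellinger_def
    by (rule nn_integral_cong_AE) (use ac in eventually_elim, auto simp: tilt_def p_nonneg)
  then have h1: "hellinger 1 = 1" by (simp add: nn_integral_p)
  then have hr1: "hellinger_real 1 = 1"
    using hellinger_eq_real[of 1] hellinger_real_nonneg[of 1] by simp
  \<comment> \<open>This is the Kullback-Leibler divergence, obtained by differentiating
    \<open>tilt\<close> in the order under the integral at 1.\<close>
  define d where "d = (\<integral> x. tilt 1 x * (ln (p x) - ln (q x)) \<partial>\<mu>)"
  \<comment> \<open>Restricting s to [-\<delta>, \<delta>] makes the domination hold for every term
    of every test sequence; the restriction is lifted afterwards because 0 is interior.\<close>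
  have "((\<lambda>s. (hellinger_real (1 + s) - hellinger_real 1) / s) \<longlongrightarrow> d) (at 0 within {- \<delta>..\<delta>})"
    unfolding tendsto_at_iff_sequentially
  proof (intro allI impI)
    fix X :: "nat \<Rightarrow> real"
    assume X: "\<forall>i. X i \<in> {- \<delta>..\<delta>} - {0}" and lim: "X \<longlonglongrightarrow> 0"
    have X': "\<bar>X i\<bar> \<le> \<delta>" "X i \<noteq> 0" for i using X by (auto simp: abs_le_iff minus_le_iff)
    have "(\<lambda>n. \<integral> x. (tilt (1 + X n) x - tilt 1 x) / X n \<partial>\<mu>) \<longlonglongrightarrow> d"
      unfolding d_def
    proof (rule integral_dominated_convergence)
      show "integrable \<mu> (\<lambda>x. (tilt (1 + \<delta>) x + tilt (1 - \<delta>) x) / \<delta>)"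
        using fin\<delta>[of \<delta>] fin\<delta>[of "- \<delta>"] \<delta>
        by (intro integrable_divide Bochner_Integration.integrable_add tilt_integrable) auto
      have exp_form: "tilt (1 + s) x = tilt 1 x * exp (s * (ln (p x) - ln (q x)))"
        if "p x \<noteq> 0" "q x \<noteq> 0" for s x
        using that by (simp add: tilt_eq_exp algebra_simps flip: exp_add)
      show "AE x in \<mu>. norm ((tilt (1 + X n) x - tilt 1 x) / X n)
          \<le> (tilt (1 + \<delta>) x + tilt (1 - \<delta>) x) / \<delta>" for n
      proof (rule AE_I2)
        fix x
        show "norm ((tilt (1 + X n) x - tilt 1 x) / X n) \<le> (tilt (1 + \<delta>) x + tilt (1 - \<delta>) x) / \<delta>"
        proof (cases "p x = 0 \<or> q x = 0")
          case True
          then have "tilt c x = 0" for c by (simp add: tilt_eq_0_iff)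
          then show ?thesis by simp
        next
          case False
          define y where "y = ln (p x) - ln (q x)"
          have e: "tilt (1 + s) x = tilt 1 x * exp (s * y)" for s
            using False exp_form by (simp add: y_def)
          have "norm ((tilt (1 + X n) x - tilt 1 x) / X n)
              = tilt 1 x * (\<bar>exp (X n * y) - 1\<bar> / \<bar>X n\<bar>)"
          proof -
            have "tilt (1 + X n) x - tilt 1 x = tilt 1 x * (exp (X n * y) - 1)"
              by (simp add: e algebra_simps)
            then show ?thesis using tilt_nonneg[of 1 x] by (simp add: abs_mult)
          qed
          also have "\<dots> \<le> tilt 1 x * ((exp (\<delta> * y) + exp (- \<delta> * y)) / \<delta>)"
            using abs_exp_minus_1_le[OF \<delta> X'(1), of n y] X'(2)[of n] \<delta> tilt_nonneg[of 1 x]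
            by (intro mult_left_mono) (auto simp: field_simps)
          also have "\<dots> = (tilt (1 + \<delta>) x + tilt (1 - \<delta>) x) / \<delta>"
            using e[of \<delta>] e[of "- \<delta>"] by (simp add: algebra_simps)
          finally show ?thesis .
        qed
      qed
      show "AE x in \<mu>. (\<lambda>n. (tilt (1 + X n) x - tilt 1 x) / X n) \<longlonglongrightarrow> tilt 1 x * (ln (p x) - ln (q x))"
      proof (rule AE_I2)
        fix x
        show "(\<lambda>n. (tilt (1 + X n) x - tilt 1 x) / X n) \<longlonglongrightarrow> tilt 1 x * (ln (p x) - ln (q x))"
        proof (cases "p x = 0 \<or> q x = 0")
          case True
          then have "tilt c x = 0" for c by (simp add: tilt_eq_0_iff)
          then show ?thesis by simp
        next
          case False
          define y where "y = ln (p x) - ln (q x)"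
          have e: "tilt (1 + s) x = tilt 1 x * exp (s * y)" for s
            using False exp_form by (simp add: y_def)
          have "((\<lambda>s. tilt 1 x * exp (s * y)) has_field_derivative tilt 1 x * y) (at 0)"
            by (auto intro!: derivative_eq_intros)
          then have "((\<lambda>s. (tilt (1 + s) x - tilt 1 x) / s) \<longlongrightarrow> tilt 1 x * y) (at 0)"
            by (simp add: DERIV_def e)
          then show ?thesis
            unfolding y_def using X'(2) lim
            by (auto simp: tendsto_at_iff_sequentially comp_def)
        qed
      qed
    qed auto
    moreover have "(\<integral> x. (tilt (1 + X n) x - tilt 1 x) / X n \<partial>\<mu>)
        = (hellinger_real (1 + X n) - hellinger_real 1) / X n" for n
      unfolding hellinger_real_def using fin\<delta>[OF X'(1)[of n]] fin\<delta>[of 0] \<delta>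
      by (simp add: tilt_integrable)
    ultimately show "((\<lambda>s. (hellinger_real (1 + s) - hellinger_real 1) / s) \<circ> X) \<longlonglongrightarrow> d"
      by (simp only: comp_def)
  qed
  moreover have "at 0 within {- \<delta>..\<delta>} = at 0"
    using \<delta> by (intro at_within_interior) simp
  ultimately have "(hellinger_real has_field_derivative d) (at 1)"
    by (simp add: DERIV_def)
  then have "((\<lambda>\<alpha>. ln (hellinger_real \<alpha>)) has_field_derivative d) (at 1)"
    using hr1 by (auto intro!: derivative_eq_intros)
  then have "((\<lambda>\<alpha>. ln (hellinger_real \<alpha>) / (\<alpha> - 1)) \<longlongrightarrow> d) (at 1)"
    by (simp add: has_field_derivative_iff hr1)
  then have lim: "((\<lambda>\<alpha>. ereal (ln (hellinger_real \<alpha>) / (\<alpha> - 1))) \<longlongrightarrow> ereal d) (at 1)"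
    by (rule tendsto_ereal)
  have "eventually (\<lambda>\<alpha>. \<alpha> \<in> {0<..<b}) (at 1)"
    using b by (intro eventually_at_in_open') auto
  then have "eventually (\<lambda>\<alpha>. ereal (ln (hellinger_real \<alpha>) / (\<alpha> - 1)) = hellinger_rate \<alpha>) (at 1)"
  proof eventually_elim
    case (elim \<alpha>)
    then have "hellinger \<alpha> = ennreal (hellinger_real \<alpha>)"
      by (intro hellinger_eq_real fin) auto
    \<comment> \<open>Vanishing would carry over to order 1, where the integral equals 1.\<close>
    moreover have "hellinger \<alpha> \<noteq> 0"
      using h1 hellinger_eq_0_iff[of 1] hellinger_eq_0_iff[of \<alpha>] by simp
    ultimately show ?case
      using hellinger_real_nonneg[of \<alpha>] by (simp add: hellinger_rate_def ln_ennreal_def)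
  qed
  then show ?thesis using lim that by (blast intro: Lim_transform_eventually)
qed

section \<open>Comparison of the divergence with the rate\<close>

text \<open>The two integrands differ only where q = 0 < p: there one is infinite and
  \<open>tilt\<close> is 0. Hence either this set is null or the integral is infinite.\<close>

lemma nn_integral_renyi_above_1:
  assumes "1 < \<alpha>"
  shows "(\<integral>\<^sup>+ x. renyi_integrand \<alpha> (p x) (q x) \<partial>\<mu>)
    = (if AE x in \<mu>. q x = 0 \<longrightarrow> p x = 0 then hellinger \<alpha> else \<top>)"
proof (cases "AE x in \<mu>. q x = 0 \<longrightarrow> p x = 0")
  case True
  then have "AE x in \<mu>. renyi_integrand \<alpha> (p x) (q x) = ennreal (tilt \<alpha> x)"
  proof eventually_elim
    case (elim x)
    show ?case
    proof (cases "q x = 0")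
      case True
      then show ?thesis using elim assms by (simp add: renyi_integrand_def tilt_def)
    next
      case False
      then have "tilt \<alpha> x = p x powr \<alpha> / q x powr (\<alpha> - 1)"
        using powr_minus_divide[of "q x" "\<alpha> - 1"] by (simp add: tilt_def)
      then show ?thesis
        using False assms q_nonneg[of x]
        by (simp add: renyi_integrand_def divide_ennreal)
    qed
  qed
  then show ?thesis
    using True by (simp add: hellinger_def cong: nn_integral_cong_AE)
next
  case False
  define N where "N = {x \<in> space \<mu>. q x = 0 \<and> p x \<noteq> 0}"
  have N [measurable]: "N \<in> sets \<mu>" unfolding N_def by measurable
  have "emeasure \<mu> N \<noteq> 0"
    using False AE_iff_measurable[OF N, of "\<lambda>x. q x = 0 \<longrightarrow> p x = 0"] by (auto simp: N_def)
  then have "\<top> = (\<integral>\<^sup>+ x. \<top> * indicator N x \<partial>\<mu>)"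
    using nn_integral_cmult_indicator[OF N, of \<top>] by (simp add: ennreal_top_mult)
  also have "\<dots> \<le> (\<integral>\<^sup>+ x. renyi_integrand \<alpha> (p x) (q x) \<partial>\<mu>)"
    using assms
    by (intro nn_integral_mono)
      (auto simp: renyi_integrand_def N_def ennreal_eq_0_iff split: split_indicator)
  finally show ?thesis using False by (simp add: top_unique)
qed

lemma renyi_simple_above_1:
  assumes "1 < \<alpha>"
  shows "renyi_simple \<mu> p q \<alpha> = (if AE x in \<mu>. q x = 0 \<longrightarrow> p x = 0 then hellinger_rate \<alpha> else \<infinity>)"
  using assms by (simp add: renyi_simple_def nn_integral_renyi_above_1 hellinger_rate_def ln_ennreal_def)

text \<open>Reflection to order 1 - \<alpha> > 1 with the densities exchanged. The factor
  1/(\<alpha> - 1) is negative, so an infinite integral gives -\<infinity>.\<close>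

lemma renyi_simple_below_0:
  assumes "\<alpha> < 0"
  shows "renyi_simple \<mu> p q \<alpha> = (if AE x in \<mu>. p x = 0 \<longrightarrow> q x = 0 then hellinger_rate \<alpha> else - \<infinity>)"
proof -
  interpret swap: density_pair \<mu> q p by (rule density_pair_swap)
  have "renyi_integrand \<alpha> u v = renyi_integrand (1 - \<alpha>) v u" for u v
    using assms by (simp add: renyi_integrand_def)
  then show ?thesis
    using assms swap.nn_integral_renyi_above_1[of "1 - \<alpha>"]
    by (simp add: renyi_simple_def hellinger_rate_def ln_ennreal_def swap_hellinger)
qed

lemma renyi_simple_unit:
  assumes "0 < \<alpha>" "\<alpha> < 1"
  shows "renyi_simple \<mu> p q \<alpha> = hellinger_rate \<alpha>"
  using assms by (simp add: renyi_simple_def renyi_integrand_def hellinger_rate_def hellinger_def tilt_def)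

lemma hellinger_finite_if_rate_finite:
  assumes "\<alpha> \<noteq> 1" "\<bar>hellinger_rate \<alpha>\<bar> < \<infinity>"
  shows "hellinger \<alpha> < \<top>"
  using assms by (cases "hellinger \<alpha> = \<top>") (auto simp: hellinger_rate_def ln_ennreal_def less_top split: if_splits)

text \<open>Monotonicity makes the limit exist, so the \<open>Lim\<close> in the definition really
  denotes it.\<close>

lemma tendsto_renyi_simple_at_top:
  "(renyi_simple \<mu> p q \<longlongrightarrow> renyi_divergence \<mu> p q \<infinity>) at_top"
proof -
  have "(renyi_simple \<mu> p q \<longlongrightarrow> (SUP \<alpha>\<in>{1<..}. renyi_simple \<mu> p q \<alpha>)) at_top"
    by (rule tendsto_at_top_mono_ereal) (auto simp: renyi_simple_above_1 hellinger_rate_mono_above_1)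
  from tendsto_Lim[OF _ this] this show ?thesis by (simp add: renyi_divergence_def)
qed

lemma tendsto_renyi_simple_at_bot:
  "(renyi_simple \<mu> p q \<longlongrightarrow> renyi_divergence \<mu> p q (- \<infinity>)) at_bot"
proof -
  have "(renyi_simple \<mu> p q \<longlongrightarrow> (INF \<alpha>\<in>{..<0}. renyi_simple \<mu> p q \<alpha>)) at_bot"
    by (rule tendsto_at_bot_mono_ereal) (auto simp: renyi_simple_below_0 hellinger_rate_mono_below_1)
  from tendsto_Lim[OF _ this] this show ?thesis by (simp add: renyi_divergence_def)
qed

text \<open>The rate is monotone on all of (-\<infinity>, 1) and agrees with
  \<open>renyi_simple\<close> on (0, 1), which determines the left limit.\<close>

lemma tendsto_hellinger_rate_at_left_1:
  "(hellinger_rate \<longlongrightarrow> renyi_divergence \<mu> p q 1) (at_left 1)"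
proof -
  have lim: "(hellinger_rate \<longlongrightarrow> (SUP \<alpha>\<in>{..<1}. hellinger_rate \<alpha>)) (at_left 1)"
    by (rule tendsto_at_left_mono_ereal) (rule hellinger_rate_mono_below_1)
  have "eventually (\<lambda>\<alpha>. hellinger_rate \<alpha> = renyi_simple \<mu> p q \<alpha>) (at_left 1)"
    using eventually_at_left_real[OF zero_less_one] by eventually_elim (auto simp: renyi_simple_unit)
  with lim have "(renyi_simple \<mu> p q \<longlongrightarrow> (SUP \<alpha>\<in>{..<1}. hellinger_rate \<alpha>)) (at_left 1)"
    by (rule Lim_transform_eventually)
  from tendsto_Lim[OF _ this] lim show ?thesis by (simp add: renyi_divergence_def)
qed

text \<open>Since \<open>0 powr 0 = 0\<close>, \<open>tilt 0\<close> is \<open>q\<close> restricted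
  to p > 0, the pointwise limit from the right; thus order 0 behaves like the other orders.\<close>

lemma renyi_divergence_0: "renyi_divergence \<mu> p q 0 = hellinger_rate 0"
proof -
  have "(hellinger_rate \<longlongrightarrow> hellinger_rate 0) (at 0 within {0..1})"
    by (rule tendsto_within_subset[OF tendsto_hellinger_rate]) (auto simp: hellinger_finite_unit)
  then have "(hellinger_rate \<longlongrightarrow> hellinger_rate 0) (at_right 0)"
    by (simp add: at_within_Icc_at_right)
  moreover have "eventually (\<lambda>\<alpha>. hellinger_rate \<alpha> = renyi_simple \<mu> p q \<alpha>) (at_right 0)"
    using eventually_at_right_real[OF zero_less_one] by eventually_elim (auto simp: renyi_simple_unit)
  ultimately have "(renyi_simple \<mu> p q \<longlongrightarrow> hellinger_rate 0) (at_right 0)"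
    by (rule Lim_transform_eventually)
  from tendsto_Lim[OF _ this] show ?thesis by (simp add: renyi_divergence_def)
qed

text \<open>Off [0,1], a finite divergence excludes the infinite branch, and a finite rate forces a
  finite integral. On [0,1] the integral is always finite, even where the rate is not.\<close>

lemma renyi_divergence_eq_rate:
  assumes "\<alpha> \<noteq> 1" and "0 \<le> \<alpha> \<and> \<alpha> \<le> 1 \<or> \<bar>renyi_divergence \<mu> p q (ereal \<alpha>)\<bar> < \<infinity>"
  shows "hellinger \<alpha> < \<top> \<and> renyi_divergence \<mu> p q (ereal \<alpha>) = hellinger_rate \<alpha>"
proof -
  have simple: "renyi_divergence \<mu> p q (ereal \<alpha>) = renyi_simple \<mu> p q \<alpha>" if "\<alpha> \<noteq> 0"
    using that assms(1) by (simp add: renyi_divergence_def)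
  consider "\<alpha> < 0" | "\<alpha> = 0" | "0 < \<alpha>" "\<alpha> < 1" | "1 < \<alpha>" using assms(1) by linarith
  then show ?thesis
  proof cases
    case 1
    then have "renyi_divergence \<mu> p q (ereal \<alpha>) = hellinger_rate \<alpha>"
      using assms simple by (auto simp: renyi_simple_below_0 split: if_splits)
    then show ?thesis using 1 assms hellinger_finite_if_rate_finite[of \<alpha>] by simp
  next
    case 2
    then show ?thesis by (simp add: renyi_divergence_0 hellinger_finite_unit flip: zero_ereal_def)
  next
    case 3
    then show ?thesis using simple by (simp add: renyi_simple_unit hellinger_finite_unit)
  next
    case 4
    then have "renyi_divergence \<mu> p q (ereal \<alpha>) = hellinger_rate \<alpha>"
      using assms simple by (auto simp: renyi_simple_above_1 split: if_splits)
    then show ?thesis using 4 assms hellinger_finite_if_rate_finite[of \<alpha>] by simp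
  qed
qed

section \<open>Continuity at each order of the set\<close>

lemma continuous_on_renyi_divergence:
  "continuous_on {\<alpha>. (0 \<le> \<alpha> \<and> \<alpha> \<le> 1) \<or> \<bar>renyi_divergence \<mu> p q \<alpha>\<bar> < \<infinity>} (renyi_divergence \<mu> p q)"
  (is "continuous_on ?A ?D")
proof -
  define A where "A = ?A"
  have "(?D \<longlongrightarrow> ?D a) (at a within A)" if a: "a \<in> A" for a
  proof -
    have rate: "hellinger \<alpha> < \<top> \<and> ?D (ereal \<alpha>) = hellinger_rate \<alpha>"
      if "ereal \<alpha> \<in> A" "\<alpha> \<noteq> 1" for \<alpha>
      using renyi_divergence_eq_rate[of \<alpha>] that by (simp add: A_def)
    \<comment> \<open>At \<infinity> and -\<infinity> convergence holds along all real orders, by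
      definition of the limit orders. Orders 0 and 1 are avoided because \<open>renyi_simple\<close>
      is the divergence only away from them.\<close>
    have infinite: "(?D \<longlongrightarrow> ?D a) (at a within A)"
      if at: "at a = filtermap ereal F" and lim: "(renyi_simple \<mu> p q \<longlongrightarrow> ?D a) F"
        and ev: "eventually (\<lambda>\<alpha>. \<alpha> \<noteq> 0 \<and> \<alpha> \<noteq> 1) F" for F
    proof -
      have "eventually (\<lambda>\<alpha>. renyi_simple \<mu> p q \<alpha> = ?D (ereal \<alpha>)) F"
        using ev by eventually_elim (simp add: renyi_divergence_def)
      with lim have "((\<lambda>\<alpha>. ?D (ereal \<alpha>)) \<longlongrightarrow> ?D a) F" by (rule Lim_transform_eventually)
      then have "(?D \<longlongrightarrow> ?D a) (at a)" by (simp add: at filterlim_filtermap)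
      then show ?thesis by (rule tendsto_within_subset) simp
    qed
    consider "a = \<infinity>" | "a = - \<infinity>" | r where "a = ereal r" "r \<noteq> 1" | "a = ereal 1"
      by (cases a) auto
    then show "(?D \<longlongrightarrow> ?D a) (at a within A)"
    proof cases
      case 1
      have "eventually (\<lambda>\<alpha>::real. \<alpha> \<noteq> 0 \<and> \<alpha> \<noteq> 1) at_top"
        using eventually_gt_at_top[of 1] by eventually_elim auto
      then show ?thesis
        using 1 tendsto_renyi_simple_at_top by (intro infinite[of at_top]) (simp_all add: at_infty_ereal_eq_at_top)
    next
      case 2
      have "eventually (\<lambda>\<alpha>::real. \<alpha> \<noteq> 0 \<and> \<alpha> \<noteq> 1) at_bot"
        using eventually_gt_at_bot[of 0] by eventually_elim auto
      then show ?thesis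
        using 2 tendsto_renyi_simple_at_bot by (intro infinite[of at_bot]) (simp_all add: at_minus_infty_ereal_eq_at_bot)
    next
      case (3 r)
      have r: "hellinger r < \<top>" "?D (ereal r) = hellinger_rate r" using rate[of r] 3 a by auto
      \<comment> \<open>Order 1 is removed first, as the rate has a default value there; this does
        not change the filter at r \<noteq> 1.\<close>
      have "(?D \<longlongrightarrow> hellinger_rate r) (at (ereal r) within (A - {1}))"
      proof (rule tendsto_at_ereal_within[OF tendsto_hellinger_rate])
        fix \<alpha> assume "ereal \<alpha> \<in> A - {1}"
        then show "\<alpha> \<in> {\<alpha>. hellinger \<alpha> < \<top>} \<and> ?D (ereal \<alpha>) = hellinger_rate \<alpha>"
          using rate[of \<alpha>] by (simp add: one_ereal_def)
      qed (use 3 r in simp_all)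
      moreover have "at (ereal r) within (A - {1}) = at (ereal r) within A"
        using 3 by (intro at_within_nhd[of _ "- {1}"]) (auto simp: one_ereal_def)
      ultimately show ?thesis using 3 r by simp
    next
      case 4
      show ?thesis
      proof (cases "\<exists>b>1. ereal b \<in> A")
        \<comment> \<open>Near 1 the set then has no orders above 1, so the left limit defining
          order 1 suffices.\<close>
        case False
        have below: "\<alpha> \<in> {..<1}" if "ereal \<alpha> \<in> A" "\<alpha> \<noteq> 1" for \<alpha>
          using that False by (metis lessThan_iff linorder_neqE_linordered_idom)
        have "(?D \<longlongrightarrow> ?D 1) (at (ereal 1) within A)"
          using tendsto_hellinger_rate_at_left_1
          by (rule tendsto_at_ereal_within) (use below rate in blast)
        then show ?thesis using 4 by (simp add: one_ereal_def)
      next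
        case True
        then obtain b where b: "1 < b" "ereal b \<in> A" by blast
        have "\<bar>?D (ereal b)\<bar> < \<infinity>" using b by (auto simp: A_def)
        then have ac: "AE x in \<mu>. q x = 0 \<longrightarrow> p x = 0"
          using b(1) by (auto simp: renyi_divergence_def renyi_simple_above_1 split: if_splits)
        obtain d where d: "(hellinger_rate \<longlongrightarrow> ereal d) (at 1)"
          using tendsto_hellinger_rate_at_1[OF ac b(1)] rate[OF b(2)] b(1) by auto
        \<comment> \<open>The divergence at 1 is the left limit of the rate, and the two-sided limit
          \<open>d\<close> restricts to it.\<close>
        have "?D 1 = ereal d"
          using tendsto_unique[OF _ tendsto_hellinger_rate_at_left_1 tendsto_within_subset[OF d]] by simp
        moreover have "(?D \<longlongrightarrow> ereal d) (at (ereal 1) within A)"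
          using d by (rule tendsto_at_ereal_within) (use rate in blast)
        ultimately show ?thesis using 4 by (simp add: one_ereal_def)
      qed
    qed
  qed
  then show ?thesis by (simp add: A_def continuous_on_def)
qed

end

theorem theorem40:
  fixes P Q \<mu> :: "'a measure" and p q :: "'a \<Rightarrow> real"
  assumes "prob_space P" and "prob_space Q"
    and "sigma_finite_measure \<mu>"
    and "p \<in> borel_measurable \<mu>" and "\<And>x. 0 \<le> p x" and "P = density \<mu> (\<lambda>x. ennreal (p x))"
    and "q \<in> borel_measurable \<mu>" and "\<And>x. 0 \<le> q x" and "Q = density \<mu> (\<lambda>x. ennreal (q x))"
  shows "continuous_on
           {\<alpha> :: ereal. (0 \<le> \<alpha> \<and> \<alpha> \<le> 1) \<or> \<bar>renyi_divergence \<mu> p q \<alpha>\<bar> < \<infinity>}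
           (renyi_divergence \<mu> p q)"
proof -
  have total: "(\<integral>\<^sup>+ x. ennreal (f x) \<partial>\<mu>) = 1"
    if "prob_space (density \<mu> (\<lambda>x. ennreal (f x)))" "f \<in> borel_measurable \<mu>" for f
    using prob_space.emeasure_space_1[OF that(1)] that(2)
    by (simp add: emeasure_density cong: nn_integral_cong)
  interpret density_pair \<mu> p q
    using assms by unfold_locales (auto intro: total)
  show ?thesis by (rule continuous_on_renyi_divergence)
qed

end
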